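(* Let $\phi(z_1),\alpha(z_1),\beta(z_2)$ be differentiable functions and let $X$ be parametrized in local coordinates $(z_1,z_2)$ by $$\boldsymbol{F}(z_1,z_2)=\big(\phi(z_1)\cos(\alpha(z_1)+\beta(z_2)+C\pi),\ \phi(z_1)\sin(\alpha(z_1)+\beta(z_2)+C\pi),\ z_1+iz_2\big),$$ with $C$ a constant. Then $(z_1,z_2)$ are local isothermal coordinates on $X$ if and only if $$\left(\frac{d\phi}{dz_1}\right)^2+\phi^2(z_1)\left[\left(\frac{d\alpha}{dz_1}\right)^2-\left(\frac{d\beta}{dz_2}\right)^2+2i\frac{d\beta}{dz_2}\frac{d\alpha}{dz_1}\right]=0 .$$
   Context: The coefficients of the first fundamental form $E\,dz_1^2+2F\,dz_1dz_2+G\,dz_2^2$ are $E=\langle\boldsymbol{F}_{z_1},\boldsymbol{F}_{z_1}\rangle$, $F=\langle\boldsymbol{F}_{z_1},\boldsymbol{F}_{z_2}\rangle$, $G=\langle\boldsymbol{F}_{z_2},\boldsymbol{F}_{z_2}\rangle$, where subscripts denote partial derivatives and $\langle\cdot,\cdot\rangle$ is the complex-bilinear product $\langle a,b\rangle=a_1b_1+a_2b_2+a_3b_3$. The criterion used in the paper for $(z_1,z_2)$ (with complex coordinate $z_1+iz_2$) to be isothermal is that the Beltrami coefficient $\mu=\dfrac{E-G+2iF}{E+G+2\sqrt{EG-F^2}}$ vanishes, i.e. $E-G+2iF=0$. *)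

theory Defs
  imports "HOL-Analysis.Analysis"
begin

definition bilin :: "complex^3 \<Rightarrow> complex^3 \<Rightarrow> complex" where
  "bilin a b = a $ 1 * b $ 1 + a $ 2 * b $ 2 + a $ 3 * b $ 3"

definition pd1 :: "(real \<times> real \<Rightarrow> complex^3) \<Rightarrow> real \<times> real \<Rightarrow> complex^3" where
  "pd1 r p = vector_derivative (\<lambda>t. r (t, snd p)) (at (fst p))"

definition pd2 :: "(real \<times> real \<Rightarrow> complex^3) \<Rightarrow> real \<times> real \<Rightarrow> complex^3" where
  "pd2 r p = vector_derivative (\<lambda>t. r (fst p, t)) (at (snd p))"

definition coeff_E :: "(real \<times> real \<Rightarrow> complex^3) \<Rightarrow> real \<times> real \<Rightarrow> complex" where
  "coeff_E r p = bilin (pd1 r p) (pd1 r p)"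

definition coeff_F :: "(real \<times> real \<Rightarrow> complex^3) \<Rightarrow> real \<times> real \<Rightarrow> complex" where
  "coeff_F r p = bilin (pd1 r p) (pd2 r p)"

definition coeff_G :: "(real \<times> real \<Rightarrow> complex^3) \<Rightarrow> real \<times> real \<Rightarrow> complex" where
  "coeff_G r p = bilin (pd2 r p) (pd2 r p)"

definition beltrami_num :: "(real \<times> real \<Rightarrow> complex^3) \<Rightarrow> real \<times> real \<Rightarrow> complex" where
  "beltrami_num r p = coeff_E r p - coeff_G r p + 2 * \<i> * coeff_F r p"

definition beltrami_den :: "(real \<times> real \<Rightarrow> complex^3) \<Rightarrow> real \<times> real \<Rightarrow> complex" where
  "beltrami_den r p =
     coeff_E r p + coeff_G r p + 2 * csqrt (coeff_E r p * coeff_G r p - (coeff_F r p)\<^sup>2)"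

definition beltrami :: "(real \<times> real \<Rightarrow> complex^3) \<Rightarrow> real \<times> real \<Rightarrow> complex" where
  "beltrami r p = beltrami_num r p / beltrami_den r p"

text \<open>
  The criterion ``the Beltrami coefficient vanishes'' is taken in the form \<open>E - G + 2iF = 0\<close>.
  The denominator may be zero (for instance \<open>E = -3\<close>, \<open>F = \<i>\<close>, \<open>G = -1\<close>), and then the
  convention \<open>x / 0 = 0\<close> would make \<open>beltrami r p = 0\<close> true for any numerator. Wherever the
  denominator is nonzero the two forms agree.
\<close>

definition isothermal_on :: "(real \<times> real \<Rightarrow> complex^3) \<Rightarrow> (real \<times> real) set \<Rightarrow> bool" where
  "isothermal_on r U \<longleftrightarrow>
     (\<forall>p\<in>U. coeff_E r p - coeff_G r p + 2 * \<i> * coeff_F r p = 0)"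

lemma isothermal_on_iff_beltrami:
  assumes "\<And>p. p \<in> U \<Longrightarrow> beltrami_den r p \<noteq> 0"
  shows "isothermal_on r U \<longleftrightarrow> (\<forall>p\<in>U. beltrami r p = 0)"
  using assms by (auto simp: isothermal_on_def beltrami_def beltrami_num_def)

lemma isothermal_on_imp_beltrami:
  "isothermal_on r U \<Longrightarrow> p \<in> U \<Longrightarrow> beltrami r p = 0"
  by (simp add: isothermal_on_def beltrami_def beltrami_num_def)

end

theory Submission
  imports Defs
begin

text \<open>
  At a point of \<^term>\<open>U\<close> each coordinate line of the surface is a curve
  \<open>(\<rho> cos \<theta>, \<rho> sin \<theta>, l)\<close> in cylindrical form. Its velocity is the rotation by \<open>\<theta>\<close> of
  \<open>(\<rho>', \<rho> \<theta>', l')\<close>, and the bilinear product of two velocities over the same point is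
  \<open>\<rho>\<^sub>1' \<rho>\<^sub>2' + \<rho>\<^sup>2 \<theta>\<^sub>1' \<theta>\<^sub>2' + l\<^sub>1' l\<^sub>2'\<close>, because \<open>cos\<^sup>2 \<theta> + sin\<^sup>2 \<theta> = 1\<close> also for complex \<open>\<theta>\<close>
  (lemmas \<open>cylindrical_curve_has_vector_derivative\<close> and \<open>bilin_cylindrical_velocity\<close>).
  The first coordinate line has velocity data \<open>(\<phi>', \<alpha>', 1)\<close> and the second \<open>(0, \<beta>', \<i>)\<close>, so
  \<open>E = \<phi>'\<^sup>2 + \<phi>\<^sup>2 \<alpha>'\<^sup>2 + 1\<close>, \<open>F = \<phi>\<^sup>2 \<alpha>' \<beta>' + \<i>\<close> and \<open>G = \<phi>\<^sup>2 \<beta>'\<^sup>2 - 1\<close>. In \<open>E - G + 2\<i>F\<close> the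
  contributions of the third component cancel, \<open>1 + 1 + 2\<i>\<^sup>2 = 0\<close>, and what remains is the left-hand
  side of the stated equation; the equivalence therefore holds point by point.
\<close>

lemma has_vector_derivative_vector_3:
  fixes f g h :: "real \<Rightarrow> 'a::real_normed_vector"
  assumes "(f has_vector_derivative f') (at x)"
    and "(g has_vector_derivative g') (at x)"
    and "(h has_vector_derivative h') (at x)"
  shows "((\<lambda>t. vector [f t, g t, h t] :: 'a^3) has_vector_derivative vector [f', g', h']) (at x)"
proof -
  have split: "vector [a, b, c] = axis 1 a + axis 2 b + (axis 3 c :: 'a^3)" for a b c :: 'a
    by (simp add: vec_eq_iff forall_3 axis_def)
  have "bounded_linear (axis i :: 'a \<Rightarrow> 'a^3)" for i
    by (rule bounded_linear_intro[where K = 1])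
       (auto simp: vec_eq_iff axis_def norm_vec_def L2_set_def if_distrib[of norm]
          if_distrib[of "\<lambda>x. x\<^sup>2"] cong: if_cong)
  note axis = bounded_linear.has_vector_derivative[OF this]
  show ?thesis
    unfolding split by (intro has_vector_derivative_add axis assms)
qed

text \<open>
  The velocity of a curve in (complexified) cylindrical coordinates that passes through radius
  \<open>\<rho>\<close> and angle \<open>\<theta>\<close>, when radius, angle and height change at the rates \<open>\<rho>'\<close>, \<open>\<theta>'\<close> and \<open>l'\<close>.
  All quantities are complex; the height itself does not enter.
\<close>

definition cylindrical_velocity ::
    "complex \<Rightarrow> complex \<Rightarrow> complex \<Rightarrow> complex \<Rightarrow> complex \<Rightarrow> complex^3" where
  "cylindrical_velocity \<rho> \<theta> \<rho>' \<theta>' l' =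
     vector [\<rho>' * cos \<theta> - \<rho> * \<theta>' * sin \<theta>, \<rho>' * sin \<theta> + \<rho> * \<theta>' * cos \<theta>, l']"

lemma cylindrical_curve_has_vector_derivative:
  fixes \<rho> \<theta> l :: "real \<Rightarrow> complex"
  assumes \<rho>: "(\<rho> has_vector_derivative \<rho>') (at x)"
    and \<theta>: "(\<theta> has_vector_derivative \<theta>') (at x)"
    and l: "(l has_vector_derivative l') (at x)"
  shows "((\<lambda>t. vector [\<rho> t * cos (\<theta> t), \<rho> t * sin (\<theta> t), l t] :: complex^3)
           has_vector_derivative cylindrical_velocity (\<rho> x) (\<theta> x) \<rho>' \<theta>' l') (at x)"
proof -
  have "((\<lambda>t. cos (\<theta> t)) has_vector_derivative \<theta>' * - sin (\<theta> x)) (at x)"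
    using field_vector_diff_chain_at[OF \<theta> DERIV_cos] by (simp add: o_def)
  from has_vector_derivative_mult[OF \<rho> this]
  have c: "((\<lambda>t. \<rho> t * cos (\<theta> t)) has_vector_derivative
              \<rho>' * cos (\<theta> x) - \<rho> x * \<theta>' * sin (\<theta> x)) (at x)"
    by (simp add: algebra_simps)
  have "((\<lambda>t. sin (\<theta> t)) has_vector_derivative \<theta>' * cos (\<theta> x)) (at x)"
    using field_vector_diff_chain_at[OF \<theta> DERIV_sin] by (simp add: o_def)
  from has_vector_derivative_mult[OF \<rho> this]
  have s: "((\<lambda>t. \<rho> t * sin (\<theta> t)) has_vector_derivative
              \<rho>' * sin (\<theta> x) + \<rho> x * \<theta>' * cos (\<theta> x)) (at x)"
    by (simp add: algebra_simps)
  show ?thesis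
    unfolding cylindrical_velocity_def by (rule has_vector_derivative_vector_3[OF c s l])
qed

lemma bilin_cylindrical_velocity:
  "bilin (cylindrical_velocity \<rho> \<theta> a b c) (cylindrical_velocity \<rho> \<theta> a' b' c') =
     a * a' + \<rho>\<^sup>2 * (b * b') + c * c'"
  using sin_cos_squared_add[of \<theta>]
  unfolding bilin_def cylindrical_velocity_def vector_3 by algebra

lemma differentiable_on_open_has_vector_derivative:
  fixes f :: "real \<Rightarrow> 'a::real_normed_vector"
  assumes "f differentiable_on S" "open S" "x \<in> S"
  shows "(f has_vector_derivative vector_derivative f (at x)) (at x)"
  using assms differentiable_on_eq_differentiable_at vector_derivative_works by blast

lemma vector_derivative_eq_on_open:
  assumes "(g has_vector_derivative g') (at x)" "open S" "x \<in> S" "\<And>t. t \<in> S \<Longrightarrow> f t = g t"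
  shows "vector_derivative f (at x) = g'"
  using has_vector_derivative_transform_within_open[OF assms(1-3)] assms(4)
  by (metis vector_derivative_at)

theorem mainTheorem5:
  fixes \<phi> \<alpha> \<beta> :: "real \<Rightarrow> complex" and C :: complex
    and U :: "(real \<times> real) set" and r :: "real \<times> real \<Rightarrow> complex^3"
  assumes "open U"
    and "\<phi> differentiable_on fst ` U"
    and "\<alpha> differentiable_on fst ` U"
    and "\<beta> differentiable_on snd ` U"
    and "\<And>z1 z2. (z1, z2) \<in> U \<Longrightarrow>
           r (z1, z2) = vector [\<phi> z1 * cos (\<alpha> z1 + \<beta> z2 + C * of_real pi),
                                \<phi> z1 * sin (\<alpha> z1 + \<beta> z2 + C * of_real pi),
                                of_real z1 + \<i> * of_real z2]"
  shows "isothermal_on r U \<longleftrightarrow>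
    (\<forall>(z1, z2)\<in>U.
       (vector_derivative \<phi> (at z1))\<^sup>2
       + (\<phi> z1)\<^sup>2 * ((vector_derivative \<alpha> (at z1))\<^sup>2 - (vector_derivative \<beta> (at z2))\<^sup>2
                     + 2 * \<i> * vector_derivative \<beta> (at z2) * vector_derivative \<alpha> (at z1)) = 0)"
proof -
  have "coeff_E r (z1, z2) - coeff_G r (z1, z2) + 2 * \<i> * coeff_F r (z1, z2) =
       (vector_derivative \<phi> (at z1))\<^sup>2
       + (\<phi> z1)\<^sup>2 * ((vector_derivative \<alpha> (at z1))\<^sup>2 - (vector_derivative \<beta> (at z2))\<^sup>2
                     + 2 * \<i> * vector_derivative \<beta> (at z2) * vector_derivative \<alpha> (at z1))"
    if z: "(z1, z2) \<in> U" for z1 z2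
  proof -
    define \<phi>' \<alpha>' \<beta>' where "\<phi>' = vector_derivative \<phi> (at z1)"
      and "\<alpha>' = vector_derivative \<alpha> (at z1)" and "\<beta>' = vector_derivative \<beta> (at z2)"
    define \<theta> where "\<theta> = \<alpha> z1 + \<beta> z2 + C * of_real pi"
    have z1: "z1 \<in> fst ` U" and z2: "z2 \<in> snd ` U" using z by force+
    have \<phi>: "(\<phi> has_vector_derivative \<phi>') (at z1)"
      and \<alpha>: "(\<alpha> has_vector_derivative \<alpha>') (at z1)"
      and \<beta>: "(\<beta> has_vector_derivative \<beta>') (at z2)"
      unfolding \<phi>'_def \<alpha>'_def \<beta>'_def
      using assms(1-4) z1 z2
      by (auto intro: differentiable_on_open_has_vector_derivative open_image_fst open_image_snd)
    \<comment> \<open>The formula for the surface is available only on \<open>U\<close>, so each partial derivative is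
      computed along the open slice of \<open>U\<close> through the point.\<close>
    have slice1: "open {t. (t, z2) \<in> U}" and slice2: "open {t. (z1, t) \<in> U}"
      unfolding vimage_def[of "\<lambda>t. (t, z2)", symmetric] vimage_def[of "\<lambda>t. (z1, t)", symmetric]
      by (intro open_vimage \<open>open U\<close> continuous_intros)+
    have "((\<lambda>t. \<alpha> t + \<beta> z2 + C * of_real pi) has_vector_derivative \<alpha>') (at z1)"
      by (auto intro!: derivative_eq_intros \<alpha>)
    moreover have "((\<lambda>t. of_real t + \<i> * of_real z2) has_vector_derivative 1) (at z1)"
      by (auto intro!: derivative_eq_intros)
    ultimately have "((\<lambda>t. vector [\<phi> t * cos (\<alpha> t + \<beta> z2 + C * of_real pi),
           \<phi> t * sin (\<alpha> t + \<beta> z2 + C * of_real pi), of_real t + \<i> * of_real z2] :: complex^3)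
         has_vector_derivative cylindrical_velocity (\<phi> z1) \<theta> \<phi>' \<alpha>' 1) (at z1)"
      unfolding \<theta>_def by (rule cylindrical_curve_has_vector_derivative[OF \<phi>])
    then have pd1: "pd1 r (z1, z2) = cylindrical_velocity (\<phi> z1) \<theta> \<phi>' \<alpha>' 1"
      unfolding pd1_def fst_conv snd_conv
      by (rule vector_derivative_eq_on_open[OF _ slice1]) (use z assms(5) in auto)
    have "((\<lambda>t. \<alpha> z1 + \<beta> t + C * of_real pi) has_vector_derivative \<beta>') (at z2)"
      by (auto intro!: derivative_eq_intros \<beta>)
    moreover have "((\<lambda>t. of_real z1 + \<i> * of_real t) has_vector_derivative \<i>) (at z2)"
      by (auto intro!: derivative_eq_intros)
    ultimately have "((\<lambda>t. vector [\<phi> z1 * cos (\<alpha> z1 + \<beta> t + C * of_real pi),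
           \<phi> z1 * sin (\<alpha> z1 + \<beta> t + C * of_real pi), of_real z1 + \<i> * of_real t] :: complex^3)
         has_vector_derivative cylindrical_velocity (\<phi> z1) \<theta> 0 \<beta>' \<i>) (at z2)"
      unfolding \<theta>_def
      by (rule cylindrical_curve_has_vector_derivative[OF has_vector_derivative_const])
    then have pd2: "pd2 r (z1, z2) = cylindrical_velocity (\<phi> z1) \<theta> 0 \<beta>' \<i>"
      unfolding pd2_def fst_conv snd_conv
      by (rule vector_derivative_eq_on_open[OF _ slice2]) (use z assms(5) in auto)
    show ?thesis
      unfolding coeff_E_def coeff_F_def coeff_G_def pd1 pd2 bilin_cylindrical_velocity
        \<phi>'_def[symmetric] \<alpha>'_def[symmetric] \<beta>'_def[symmetric]
      by (simp add: algebra_simps power2_eq_square)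
  qed
  then show ?thesis
    unfolding isothermal_on_def by (auto split: prod.splits)
qed

end
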